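(* Let $p$ and $q$ be probability density functions in $\mathcal G$ sharing the same support $S$. Let $l$ be a real-valued function such that $\mathrm{E}_p[l(X)]$ and $\mathrm{E}_q[l(X)]$ exist. Define $f_l^p$ to be the solution (in $f$) of the Stein equation $$\mathcal T(f,p)(x)=\left(l(x)-\mathrm{E}_p[l(X)]\right)\mathbb I_S(x),$$ and suppose that $f_l^p\in\mathcal F(q)$. Then $$\mathrm{E}_q[l(X)]-\mathrm{E}_p[l(X)]=\mathrm{E}_q\left[f_l^p(X)\,r(p,q)(X)\right].$$
   Context: Densities: we consider probability densities $p:\mathbb R\to\mathbb R^+$ whose support is an interval $S:=S_p$ with closure $\bar S=[a,b]$, for some $-\infty\le a<b\le\infty$. $\mathcal G$ denotes the collection of such densities which are (strongly) differentiable at every point in the interior of their support. For a real-valued function $l$, $\mathrm{E}_p[l(X)]:=\int_{\mathbb R}l(x)p(x)\,dx$. Test functions: for $p\in\mathcal G$ with support $S$, $\mathcal F(p)$ is the collection of functions $f:\mathbb R\to\mathbb R$ such that the mapping $x\mapsto f(x)p(x)$ is bounded on $\mathbb R$ and strongly differentiable on the interior of $S$. Differential in the sense of distributions: if $h$ is a real bounded function with support $S$ that is (strongly) differentiable on the interior of $S$, write $h=\tilde h\,\mathbb I_S$ with $\tilde h$ a differentiable continuation of $h$ on $\mathbb R$ ($\mathbb I_S$ is the indicator function of $S$). Then $\partial_y h(y)|_{y=x}$ denotes the differential in the sense of distributions of $h$ evaluated at $x$, so that $\partial_y h(y)|_{y=x}=(\tilde h)'(x)\mathbb I_S(x)+\tilde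 h(x)\left(\delta_{\{x=a\}}-\delta_{\{x=b\}}\right)$, where $\delta$ represents a Dirac delta. Stein operator: with $\mathbb R^\star$ the collection of all functions $f:\mathbb R\to\mathbb R$, the (location-based) Stein operator is $\mathcal T:\mathbb R^\star\times\mathcal G\to\mathbb R^\star$, $(f,p)\mapsto\mathcal T(f,p)$, where $$\mathcal T(f,p)(x)=\frac{\partial_y(f(y)p(y))|_{y=x}}{p(x)}$$ for all $f$ for which the differential (in the sense of distributions) exists. Whenever $p$ is well-behaved, the solution of the Stein equation in the claim is $f_l^p(x)=\frac{1}{p(x)}\int_a^x(l(u)-\mathrm{E}_p[l(X)])p(u)\,du$. Generalized score: for $p,q\in\mathcal G$ sharing support $S$, $r(p,q)(x):=\frac{p'(x)}{p(x)}-\frac{q'(x)}{q(x)}+\left(\delta_{\{x=a\}}-\delta_{\{x=b\}}\right)\mathbb I_S(x)$; whenever $S=\mathbb R$ or $S$ is an open interval, this simplifies to $p'/p-q'/q$. Convention: whenever an expression involves division by an indicator function $\mathbb I_A$ of a measurable set $A$, the expression is multiplied by that indicator function instead; in particular ratios $p(x)/p(x)$ do not necessarily simplify to $1$.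
   Formalization: Existence of E_q[f_l^p(X) r(p,q)(X)] is added as an assumption; it can fail otherwise (p=1, q=Z(1+½sin(1/x²)) on (0,1), l(x)=x). f_l^p is the integral solution (1/p(x))∫_a^x(l−E_p[l])p. *)

theory Defs
  imports "HOL-Analysis.Analysis"
begin

section \<open>Densities, expectations and test functions\<close>

text \<open>The support is the set where the density does not vanish; it is not closed up, so it may
  contain both, one or none of its end points.\<close>

abbreviation supp :: "(real \<Rightarrow> real) \<Rightarrow> real set"
  where "supp p \<equiv> support_on UNIV p"

definition class_G :: "(real \<Rightarrow> real) set"
  where "class_G = {p. (\<forall>x. 0 \<le> p x) \<and> integrable lborel p \<and> (LINT x|lborel. p x) = 1 \<and>
    is_interval (supp p) \<and> (\<forall>x\<in>interior (supp p). p differentiable (at x))}"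

definition has_expect :: "(real \<Rightarrow> real) \<Rightarrow> (real \<Rightarrow> real) \<Rightarrow> bool"
  where "has_expect p l \<longleftrightarrow> integrable lborel (\<lambda>x. l x * p x)"

definition expect :: "(real \<Rightarrow> real) \<Rightarrow> (real \<Rightarrow> real) \<Rightarrow> real"
  where "expect p l = (LINT x|lborel. l x * p x)"

definition class_F :: "(real \<Rightarrow> real) \<Rightarrow> (real \<Rightarrow> real) set"
  where "class_F p = {f. bounded (range (\<lambda>x. f x * p x)) \<and>
    (\<forall>x\<in>interior (supp p). (\<lambda>y. f y * p y) differentiable (at x))}"


section \<open>Functions with Dirac masses\<close>

text \<open>\<open>GenFun g m\<close> stands for the generalized function \<open>g(x) + (\<Sum>c. m(c) \<delta>\<^sub>c)\<close>,
  where \<open>m\<close> has finite support.  Multiplying \<open>\<delta>\<^sub>c\<close> by a function \<open>k\<close> gives \<open>k(c) \<delta>\<^sub>c\<close>.\<close>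

datatype genfun = GenFun (reg: "real \<Rightarrow> real") (atoms: "real \<Rightarrow> real")

definition of_fun :: "(real \<Rightarrow> real) \<Rightarrow> genfun"
  where "of_fun g = GenFun g (\<lambda>c. 0)"

definition gen_mult :: "(real \<Rightarrow> real) \<Rightarrow> genfun \<Rightarrow> genfun"
  where "gen_mult k D = GenFun (\<lambda>x. k x * reg D x) (\<lambda>c. k c * atoms D c)"

text \<open>As \<open>y / 0 = 0\<close>, division by a density multiplies by the indicator function of its support.\<close>

definition gen_divide :: "genfun \<Rightarrow> (real \<Rightarrow> real) \<Rightarrow> genfun"
  where "gen_divide D k = GenFun (\<lambda>x. reg D x / k x) (\<lambda>c. atoms D c / k c)"

definition gen_eq :: "genfun \<Rightarrow> genfun \<Rightarrow> bool"
  where "gen_eq D D' \<longleftrightarrow> (AE x in lborel. reg D x = reg D' x) \<and> atoms D = atoms D'"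

definition has_gen_expect :: "(real \<Rightarrow> real) \<Rightarrow> genfun \<Rightarrow> bool"
  where "has_gen_expect p D \<longleftrightarrow> has_expect p (reg D) \<and> finite {c. atoms D c \<noteq> 0}"

definition gen_expect :: "(real \<Rightarrow> real) \<Rightarrow> genfun \<Rightarrow> real"
  where "gen_expect p D = expect p (reg D) + (\<Sum>c | atoms D c \<noteq> 0. atoms D c * p c)"

definition left_end :: "real set \<Rightarrow> ereal"
  where "left_end S = (INF x\<in>S. ereal x)"

definition right_end :: "real set \<Rightarrow> ereal"
  where "right_end S = (SUP x\<in>S. ereal x)"

text \<open>The coefficients of \<open>\<delta>\<^sub>a - \<delta>\<^sub>b\<close>; an infinite end point contributes nothing.\<close>

definition end_masses :: "real set \<Rightarrow> real \<Rightarrow> real"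
  where "end_masses S c = of_bool (ereal c = left_end S) - of_bool (ereal c = right_end S)"


section \<open>Differential in the sense of distributions\<close>

definition locally_integrable :: "(real \<Rightarrow> real) \<Rightarrow> bool"
  where "locally_integrable g \<longleftrightarrow> (\<forall>K. compact K \<longrightarrow> set_integrable lborel K g)"

definition test_function :: "(real \<Rightarrow> real) \<Rightarrow> bool"
  where "test_function \<phi> \<longleftrightarrow>
    (\<forall>k x. ((deriv ^^ k) \<phi>) differentiable (at x)) \<and> compact (closure (supp \<phi>))"

definition has_dist_diff :: "(real \<Rightarrow> real) \<Rightarrow> genfun \<Rightarrow> bool"
  where "has_dist_diff h D \<longleftrightarrow> locally_integrable h \<and> locally_integrable (reg D) \<and>
    finite {c. atoms D c \<noteq> 0} \<and>
    (\<forall>\<phi>. test_function \<phi> \<longrightarrow>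
      - (LINT x|lborel. h x * deriv \<phi> x) =
        (LINT x|lborel. reg D x * \<phi> x) + (\<Sum>c | atoms D c \<noteq> 0. atoms D c * \<phi> c))"

lemma test_function_facts:
  assumes "test_function \<phi>"
  obtains M where "M > 0" "\<And>x. \<bar>x\<bar> > M \<Longrightarrow> \<phi> x = 0" "\<And>x. \<bar>x\<bar> > M \<Longrightarrow> deriv \<phi> x = 0"
    "\<And>x. (\<phi> has_real_derivative deriv \<phi> x) (at x)"
    "continuous_on UNIV \<phi>" "continuous_on UNIV (deriv \<phi>)"
proof -
  have D: "((deriv ^^ k) \<phi>) differentiable (at x)" for k x
    using assms by (auto simp: test_function_def)
  have d0: "(\<phi> has_real_derivative deriv \<phi> x) (at x)" for x
    using D[of 0 x] by (simp add: DERIV_deriv_iff_real_differentiable)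
  have d1: "deriv \<phi> differentiable (at x)" for x
    using D[of 1 x] by simp
  have "bounded (supp \<phi>)"
    using assms bounded_closure_image[of id] compact_imp_bounded bounded_subset closure_subset
    unfolding test_function_def by metis
  then obtain M where M: "M > 0" "\<And>x. x \<in> supp \<phi> \<Longrightarrow> \<bar>x\<bar> \<le> M"
    by (metis bounded_pos real_norm_def)
  have z: "\<phi> x = 0" if "\<bar>x\<bar> > M" for x
    using M(2)[of x] that by (auto simp: support_on_def)
  have z1: "deriv \<phi> x = 0" if "\<bar>x\<bar> > M" for x
  proof -
    have "open {x::real. \<bar>x\<bar> > M}"
      by (intro open_Collect_less continuous_intros)
    then have "eventually (\<lambda>y. \<bar>y\<bar> > M) (nhds x)"
      using that eventually_nhds by blast
    then have "eventually (\<lambda>y. \<phi> y = (\<lambda>_. 0) y) (nhds x)"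
      by eventually_elim (use z in auto)
    then have "deriv \<phi> x = deriv (\<lambda>_. 0) x"
      by (rule deriv_cong_ev) auto
    then show ?thesis by simp
  qed
  show thesis
    using that[of M] M(1) z z1 d0 DERIV_isCont[OF d0] differentiable_imp_continuous_within[OF d1]
    by (simp add: continuous_on_eq_continuous_at)
qed

lemma locally_integrable_mult_cont:
  assumes "locally_integrable g" "continuous_on UNIV \<phi>" "\<And>x. \<bar>x\<bar> > M \<Longrightarrow> \<phi> x = (0::real)"
  shows "integrable lborel (\<lambda>x. g x * \<phi> x)"
proof -
  have gi: "integrable lborel (\<lambda>x. indicator {-M..M} x * g x)"
    using assms(1) unfolding locally_integrable_def set_integrable_def by (simp add: mult.commute)
  have "bounded (\<phi> ` {-M..M})"
    by (meson assms(2) compact_Icc compact_continuous_image compact_imp_bounded continuous_on_subset top_greatest)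
  then obtain C where C: "\<And>x. x \<in> {-M..M} \<Longrightarrow> \<bar>\<phi> x\<bar> \<le> C"
    unfolding bounded_iff real_norm_def ball_simps by blast
  have [measurable]: "\<phi> \<in> borel_measurable borel"
    using assms(2) by (rule borel_measurable_continuous_onI)
  have "integrable lborel (\<lambda>x. (indicator {-M..M} x * g x) * \<phi> x)"
  proof (rule Bochner_Integration.integrable_bound)
    show "integrable lborel (\<lambda>x. C * (indicator {-M..M} x * g x))"
      using gi by simp
    show "AE x in lborel. norm (indicator {-M..M} x * g x * \<phi> x) \<le> norm (C * (indicator {-M..M} x * g x))"
    proof (rule AE_I2)
      fix x show "norm (indicator {-M..M} x * g x * \<phi> x) \<le> norm (C * (indicator {-M..M} x * g x))"
      proof (cases "x \<in> {-M..M}")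
        case True
        then have "\<bar>\<phi> x\<bar> \<le> \<bar>C\<bar>" using C[OF True] by linarith
        then show ?thesis using True
          by (simp add: abs_mult mult.commute[of "\<bar>g x\<bar>"] mult_right_mono)
      qed simp
    qed
    show "(\<lambda>x. indicator {-M..M} x * g x * \<phi> x) \<in> borel_measurable lborel"
      using borel_measurable_integrable[OF gi] by measurable
  qed
  moreover have "(indicator {-M..M} x * g x) * \<phi> x = g x * \<phi> x" for x
    using assms(3)[of x] by (cases "\<bar>x\<bar> > M") (auto simp: indicator_def)
  ultimately show ?thesis by simp
qed

text \<open>If \<open>h\<close> is the restriction of a differentiable \<open>ht\<close> to \<open>S\<close>, the differential is
  \<open>ht' I\<^sub>S + ht (\<delta>\<^sub>a - \<delta>\<^sub>b)\<close>.\<close>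

lemma has_dist_diff_continuation:
  assumes S: "is_interval S" "S \<noteq> {}" and dt: "\<And>x. ht differentiable (at x)"
    and li: "locally_integrable (\<lambda>x. deriv ht x * indicator S x)"
  shows "has_dist_diff (\<lambda>x. ht x * indicator S x)
    (GenFun (\<lambda>x. deriv ht x * indicator S x) (\<lambda>c. ht c * end_masses S c))"
proof -
  define a b where "a = left_end S" and "b = right_end S"
  have Sab: "a \<le> ereal x \<and> ereal x \<le> b" if "x \<in> S" for x
    using that unfolding a_def b_def left_end_def right_end_def by (auto intro: INF_lower SUP_upper)
  have abS: "x \<in> S" if h: "a < ereal x" "ereal x < b" for x
  proof -
    obtain y where "y \<in> S" "y < x"
      using h(1) unfolding a_def left_end_def INF_less_iff by auto
    moreover obtain z where "z \<in> S" "x < z"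
      using h(2) unfolding b_def right_end_def less_SUP_iff by auto
    ultimately show ?thesis using S(1) unfolding is_interval_1 by (meson less_imp_le)
  qed
  have ab: "a \<le> b" using Sab S(2) by (meson ex_in_conv order_trans)
  have dht: "(ht has_real_derivative deriv ht x) (at x)" for x
    using dt by (simp add: DERIV_deriv_iff_real_differentiable)
  have cht: "continuous_on UNIV ht"
    by (simp add: continuous_on_eq_continuous_at DERIV_isCont[OF dht])
  have Sm[measurable]: "S \<in> sets borel"
    using S(1) by (rule real_interval_borel_measurable)
  have l1: "locally_integrable (\<lambda>x. ht x * indicator S x)"
    unfolding locally_integrable_def
  proof (intro allI impI)
    fix K :: "real set" assume "compact K"
    then have "set_integrable lborel K ht"
      using cht unfolding set_integrable_def
      by (intro borel_integrable_compact) (auto intro: continuous_on_subset)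
    then have "set_integrable lborel (K \<inter> S) ht"
      by (rule set_integrable_subset) (use borel_compact[OF \<open>compact K\<close>] Sm in auto)
    then show "set_integrable lborel K (\<lambda>x. ht x * indicator S x)"
      unfolding set_integrable_def by (simp add: indicator_inter_arith mult.commute mult.left_commute)
  qed
  have fin: "finite {c. ht c * end_masses S c \<noteq> 0}"
  proof (rule finite_subset)
    show "{c. ht c * end_masses S c \<noteq> 0} \<subseteq> {real_of_ereal a, real_of_ereal b}"
    proof
      fix c assume "c \<in> {c. ht c * end_masses S c \<noteq> 0}"
      then have "ereal c = a \<or> ereal c = b"
        unfolding end_masses_def a_def b_def by (cases "ereal c = left_end S") auto
      then have "c = real_of_ereal a \<or> c = real_of_ereal b"
        by (metis real_of_ereal.simps(1))
      then show "c \<in> {real_of_ereal a, real_of_ereal b}" by simp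
    qed
  qed simp
  have main: "- (LINT x|lborel. (ht x * indicator S x) * deriv \<phi> x) =
      (LINT x|lborel. (deriv ht x * indicator S x) * \<phi> x) +
      (\<Sum>c | ht c * end_masses S c \<noteq> 0. ht c * end_masses S c * \<phi> c)"
    if tf: "test_function \<phi>" for \<phi>
  proof -
    obtain M where M: "M > 0" "\<And>x. \<bar>x\<bar> > M \<Longrightarrow> \<phi> x = 0" "\<And>x. \<bar>x\<bar> > M \<Longrightarrow> deriv \<phi> x = 0"
      and dphi: "\<And>x. (\<phi> has_real_derivative deriv \<phi> x) (at x)"
      and cphi: "continuous_on UNIV \<phi>" "continuous_on UNIV (deriv \<phi>)"
      using test_function_facts[OF tf] by metis
    define cl where "cl e = real_of_ereal (max (ereal (-M-1)) (min (ereal (M+1)) e))" for e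
    define A B where "A = cl a" and "B = cl b"
    have cle: "ereal (cl e) = max (ereal (-M-1)) (min (ereal (M+1)) e)" for e
      using M(1) unfolding cl_def by (cases e) (auto simp: max_def min_def)
    have AB: "A \<le> B"
    proof -
      have "ereal A \<le> ereal B"
        unfolding A_def B_def cle using ab by (intro max.mono min.mono) auto
      then show ?thesis by simp
    qed
    have inS: "x \<in> S \<longleftrightarrow> x \<in> {A..B}" if "\<bar>x\<bar> \<le> M" "x \<noteq> A" "x \<noteq> B" for x
    proof
      assume "x \<in> S"
      then have "a \<le> ereal x" "ereal x \<le> b" using Sab by auto
      then have "ereal A \<le> ereal x" "ereal x \<le> ereal B"
        unfolding A_def B_def cle using that(1) M(1) by (auto simp: min_le_iff_disj le_max_iff_disj)
      then show "x \<in> {A..B}" by simp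
    next
      assume "x \<in> {A..B}"
      then have "ereal A < ereal x" "ereal x < ereal B" using that by auto
      then have "a < ereal x" "ereal x < b"
        unfolding A_def B_def cle using that(1) M(1)
        by (auto simp: min_less_iff_disj less_max_iff_disj)
      then show "x \<in> S" by (rule abS)
    qed
    have i1: "integrable lborel (\<lambda>x. (ht x * indicator S x) * deriv \<phi> x)"
      by (rule locally_integrable_mult_cont[OF l1 cphi(2)]) (use M in auto)
    have i2: "integrable lborel (\<lambda>x. (deriv ht x * indicator S x) * \<phi> x)"
      by (rule locally_integrable_mult_cont[OF li cphi(1)]) (use M in auto)
    define w where "w x = ht x * deriv \<phi> x + deriv ht x * \<phi> x" for x
    have i12: "integrable lborel (\<lambda>x. indicator S x * w x)"
      using Bochner_Integration.integrable_add[OF i1 i2] by (simp add: w_def algebra_simps)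
    have ae: "AE x in lborel. indicator S x * w x = indicator {A<..<B} x * w x"
      using AE_lborel_singleton[of A] AE_lborel_singleton[of B]
    proof eventually_elim
      case (elim x)
      show ?case
      proof (cases "\<bar>x\<bar> \<le> M")
        case True
        then show ?thesis using inS[of x] elim by (auto simp: indicator_def)
      next
        case False
        then show ?thesis using M by (simp add: w_def)
      qed
    qed
    have sub: "{A<..<B} \<subseteq> S"
    proof
      fix x assume "x \<in> {A<..<B}"
      then have "ereal A < ereal x" "ereal x < ereal B" by auto
      then have "a < ereal x" "ereal x < b"
        unfolding A_def B_def cle using M(1)
        by (cases a; cases b; auto simp: max_def min_def split: if_splits)+
      then show "x \<in> S" by (rule abS)
    qed
    have iS: "set_integrable lborel S w"
      using i12 by (simp add: set_integrable_def)
    then have iw: "set_integrable lborel {A<..<B} w"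
      by (rule set_integrable_subset) (use sub in auto)
    have "(w has_integral (ht B * \<phi> B - ht A * \<phi> A)) {A..B}"
      by (rule fundamental_theorem_of_calculus[OF AB])
         (auto simp: w_def has_real_derivative_iff_has_vector_derivative[symmetric]
            intro!: derivative_eq_intros DERIV_subset[OF dht] DERIV_subset[OF dphi])
    then have "(LINT x:{A<..<B}|lborel. w x) = ht B * \<phi> B - ht A * \<phi> A"
      using set_borel_integral_eq_integral(2)[OF iw] by (simp add: has_integral_Icc_iff_Ioo integral_unique)
    moreover have "(LINT x|lborel. indicator S x * w x) = (LINT x:{A<..<B}|lborel. w x)"
      unfolding set_lebesgue_integral_def using ae i12 iw[unfolded set_integrable_def]
      by (intro integral_cong_AE) auto
    moreover have "(LINT x|lborel. indicator S x * w x) =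
      (LINT x|lborel. (ht x * indicator S x) * deriv \<phi> x) + (LINT x|lborel. (deriv ht x * indicator S x) * \<phi> x)"
      unfolding w_def Bochner_Integration.integral_add[OF i1 i2, symmetric]
      by (simp add: algebra_simps)
    moreover have "(\<Sum>c | ht c * end_masses S c \<noteq> 0. ht c * end_masses S c * \<phi> c)
        = ht A * \<phi> A - ht B * \<phi> B"
    proof -
      have cl0: "ereal c = e \<Longrightarrow> \<phi> c \<noteq> 0 \<Longrightarrow> c = cl e" for c e
      proof -
        assume "ereal c = e" "\<phi> c \<noteq> 0"
        then have "\<bar>c\<bar> \<le> M" using M(2) by force
        then show "c = cl e" unfolding cl_def \<open>ereal c = e\<close>[symmetric] by (auto simp: max_def min_def)
      qed
      have cl1: "\<phi> (cl e) \<noteq> 0 \<Longrightarrow> ereal (cl e) = e" for e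
      proof -
        assume "\<phi> (cl e) \<noteq> 0"
        then have "\<bar>cl e\<bar> \<le> M" using M(2) by force
        then show "ereal (cl e) = e" using cle[of e] M(1)
          by (cases e) (auto simp: max_def min_def split: if_splits)
      qed
      have cl2: "ht c * of_bool (ereal c = e) * \<phi> c = (if c = cl e then ht (cl e) * \<phi> (cl e) else 0)"
        for c e
      proof (cases "\<phi> c = 0")
        case True
        then show ?thesis by auto
      next
        case False
        then have "ereal c = e \<longleftrightarrow> c = cl e" using cl0 cl1 by metis
        then show ?thesis by simp
      qed
      have eq: "ht c * end_masses S c * \<phi> c =
        (if c = A then ht A * \<phi> A else 0) - (if c = B then ht B * \<phi> B else 0)" for c
        unfolding A_def B_def cl2[symmetric] end_masses_def a_def b_def
        by (simp only: right_diff_distrib left_diff_distrib)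
      have "(\<Sum>c | ht c * end_masses S c \<noteq> 0. ht c * end_masses S c * \<phi> c)
         = (\<Sum>c\<in>{c. ht c * end_masses S c \<noteq> 0} \<union> {A, B}. ht c * end_masses S c * \<phi> c)"
        using fin by (intro sum.mono_neutral_left) auto
      also have "\<dots> = ht A * \<phi> A - ht B * \<phi> B"
        unfolding eq sum_subtractf using fin by (simp add: sum.delta)
      finally show ?thesis .
    qed
    ultimately show ?thesis by simp
  qed
  show ?thesis
    unfolding has_dist_diff_def using l1 li fin main by simp
qed


section \<open>Stein operator and generalized score\<close>

definition has_stein_op :: "(real \<Rightarrow> real) \<Rightarrow> (real \<Rightarrow> real) \<Rightarrow> genfun \<Rightarrow> bool"
  where "has_stein_op f p T \<longleftrightarrow> (\<exists>D. has_dist_diff (\<lambda>y. f y * p y) D \<and> T = gen_divide D p)"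

definition solves_stein_eq :: "(real \<Rightarrow> real) \<Rightarrow> (real \<Rightarrow> real) \<Rightarrow> (real \<Rightarrow> real) \<Rightarrow> bool"
  where "solves_stein_eq p l f \<longleftrightarrow> (\<exists>T. has_stein_op f p T \<and>
    gen_eq T (of_fun (\<lambda>x. (l x - expect p l) * indicator (supp p) x)))"

text \<open>The Stein equation alone does not determine \<open>f\<close>: if the support is open then \<open>f + c / p\<close> is
  a solution whenever \<open>f\<close> is one.  The solution meant is the one given by integration from the
  left end point.\<close>

definition stein_sol :: "(real \<Rightarrow> real) \<Rightarrow> (real \<Rightarrow> real) \<Rightarrow> real \<Rightarrow> real"
  where "stein_sol p l x =
    1 / p x * (LBINT u=left_end (supp p)..ereal x. (l u - expect p l) * p u)"

text \<open>The integral formula always gives a solution of the Stein equation.\<close>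

lemma stein_sol_solves:
  assumes pG: "p \<in> class_G" and lp: "has_expect p l"
  shows "solves_stein_eq p l (stein_sol p l)"
proof -
  define w where "w u = (l u - expect p l) * p u" for u
  define H where "H x = (LINT u|lborel. indicator {..x} u * w u)" for x
  have ip: "integrable lborel p" "(LINT x|lborel. p x) = 1" and iS: "is_interval (supp p)"
    using pG by (auto simp: class_G_def)
  have il: "integrable lborel (\<lambda>x. l x * p x)"
    using lp by (simp add: has_expect_def)
  have iw: "integrable lborel w"
    using il ip unfolding w_def by (simp add: left_diff_distrib)
  then have wm[measurable]: "w \<in> borel_measurable borel" by auto
  have "(LINT u|lborel. w u) = expect p l - expect p l * (LINT x|lborel. p x)"
    unfolding w_def left_diff_distrib using il ip
    by (subst Bochner_Integration.integral_diff) (auto simp: expect_def)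
  then have w0: "(LINT u|lborel. w u) = 0" using ip by simp
  have in_supp: "x \<in> supp p \<longleftrightarrow> p x \<noteq> 0" for x by (simp add: support_on_def)
  have Hprod: "stein_sol p l x * p x = H x" for x
  proof (cases "p x = 0")
    case True
    have "(\<forall>y\<in>supp p. x < y) \<or> (\<forall>y\<in>supp p. y < x)"
    proof (rule ccontr)
      assume "\<not> ?thesis"
      then obtain y z where "y \<in> supp p" "z \<in> supp p" "y \<le> x" "x \<le> z"
        by (meson not_less)
      then have "x \<in> supp p" using iS unfolding is_interval_1 by blast
      then show False using True in_supp by simp
    qed
    then have "H x = 0"
    proof
      assume "\<forall>y\<in>supp p. x < y"
      then have "indicator {..x} u * w u = 0" for u
        using in_supp[of u] by (auto simp: w_def indicator_def)
      then show ?thesis unfolding H_def by (simp only:) simp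
    next
      assume "\<forall>y\<in>supp p. y < x"
      then have "indicator {..x} u * w u = w u" for u
        using in_supp[of u] by (auto simp: w_def indicator_def)
      then show ?thesis using w0 unfolding H_def by (simp only:)
    qed
    then show ?thesis using True by simp
  next
    case False
    define a where "a = left_end (supp p)"
    have ax: "a \<le> ereal u" if "p u \<noteq> 0" for u
      unfolding a_def left_end_def using that in_supp by (auto intro: INF_lower)
    have "AE u in lborel. indicator (einterval a (ereal x)) u *\<^sub>R w u = indicator {..x} u * w u"
      using AE_lborel_singleton[of x] AE_lborel_singleton[of "real_of_ereal a"]
    proof eventually_elim
      case (elim u)
      show ?case
      proof (cases "p u = 0 \<or> x < u")
        case True
        then show ?thesis by (auto simp: w_def indicator_def einterval_def)
      next
        case F: False
        then have "a \<le> ereal u" "a \<noteq> ereal u" "u < x" using ax elim by auto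
        then show ?thesis by (auto simp: indicator_def einterval_def)
      qed
    qed
    then have "(LINT u|lborel. indicator (einterval a (ereal x)) u *\<^sub>R w u) = H x"
      unfolding H_def by (intro integral_cong_AE) auto
    then have "(LBINT u=a..ereal x. w u) = H x"
      using ax[OF False] by (simp add: interval_lebesgue_integral_def set_lebesgue_integral_def)
    then show ?thesis using False by (simp add: stein_sol_def w_def a_def)
  qed
  have Hm[measurable]: "H \<in> borel_measurable borel"
  proof -
    have "H = (\<lambda>x. LINT u|lborel. (if u \<le> x then w u else 0))"
      unfolding H_def by (intro ext Bochner_Integration.integral_cong) (auto simp: indicator_def)
    moreover have "(\<lambda>x. LINT u|lborel. (if u \<le> x then w u else 0)) \<in> borel_measurable borel"
      by measurable
    ultimately show ?thesis by simp
  qed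
  have Hb: "\<bar>H x\<bar> \<le> (LINT u|lborel. \<bar>w u\<bar>)" for x
  proof -
    have "integrable lborel (\<lambda>u. indicator {..x} u * w u)"
      using integrable_mult_indicator[OF _ iw, of "{..x}"] by simp
    then have "(LINT u|lborel. \<bar>indicator {..x} u * w u\<bar>) \<le> (LINT u|lborel. \<bar>w u\<bar>)"
      using iw by (intro integral_mono) (auto simp: indicator_def)
    then show ?thesis
      unfolding H_def using integral_abs_bound[of lborel "\<lambda>u. indicator {..x} u * w u"] by linarith
  qed
  have liH: "locally_integrable H"
    unfolding locally_integrable_def set_integrable_def
  proof (intro allI impI)
    fix K :: "real set" assume K: "compact K"
    have Km[measurable]: "K \<in> sets borel" using K by (rule borel_compact)
    have "integrable lborel (\<lambda>x. indicator K x *\<^sub>R (LINT u|lborel. \<bar>w u\<bar>))"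
      using K emeasure_compact_finite by (intro integrable_scaleR_left) (auto simp: integrable_indicator_iff)
    then show "integrable lborel (\<lambda>x. indicator K x *\<^sub>R H x)"
    proof (rule Bochner_Integration.integrable_bound)
      show "AE x in lborel. norm (indicator K x *\<^sub>R H x) \<le> norm (indicator K x *\<^sub>R (LINT u|lborel. \<bar>w u\<bar>))"
        using Hb by (auto simp: indicator_def intro: order_trans[OF _ abs_ge_self])
    qed auto
  qed
  have liw: "locally_integrable w"
    unfolding locally_integrable_def set_integrable_def
    using integrable_mult_indicator[OF _ iw] by (auto simp: borel_compact)
  have test: "- (LINT x|lborel. H x * deriv \<phi> x) = (LINT x|lborel. w x * \<phi> x)"
    if tf: "test_function \<phi>" for \<phi>
  proof -
    obtain M where M: "M > 0" "\<And>x. \<bar>x\<bar> > M \<Longrightarrow> \<phi> x = 0" "\<And>x. \<bar>x\<bar> > M \<Longrightarrow> deriv \<phi> x = 0"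
      and dphi: "\<And>x. (\<phi> has_real_derivative deriv \<phi> x) (at x)"
      and cphi: "continuous_on UNIV \<phi>" "continuous_on UNIV (deriv \<phi>)"
      using test_function_facts[OF tf] by metis
    have phm[measurable]: "deriv \<phi> \<in> borel_measurable borel"
      using cphi(2) by (rule borel_measurable_continuous_onI)
    have "locally_integrable (\<lambda>_. 1)"
      unfolding locally_integrable_def
      unfolding set_integrable_def by (intro allI impI borel_integrable_compact continuous_on_const)
    then have iphi: "integrable lborel (deriv \<phi>)"
      using locally_integrable_mult_cont[of "\<lambda>_. 1" "deriv \<phi>" M] cphi(2) M(3) by simp
    define F where "F = (\<lambda>x u. (if u \<le> x then w u * deriv \<phi> x else 0))"
    have iG: "integrable (lborel \<Otimes>\<^sub>M lborel) (\<lambda>(x, u). deriv \<phi> x * w u)"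
      using iphi iw by (intro lborel_pair.Fubini_integrable) (auto simp: abs_mult)
    have iF: "integrable (lborel \<Otimes>\<^sub>M lborel) (\<lambda>(x, u). F x u)"
    proof (rule Bochner_Integration.integrable_bound[OF iG])
      show "(\<lambda>(x, u). F x u) \<in> borel_measurable (lborel \<Otimes>\<^sub>M lborel)"
        unfolding F_def by measurable
    qed (auto simp: F_def abs_mult)
    have "(LINT x|lborel. H x * deriv \<phi> x) = (LINT x|lborel. LINT u|lborel. F x u)"
    proof (rule Bochner_Integration.integral_cong[OF refl])
      fix x
      have "H x * deriv \<phi> x = (LINT u|lborel. (indicator {..x} u * w u) * deriv \<phi> x)"
        unfolding H_def by simp
      also have "\<dots> = (LINT u|lborel. F x u)"
        by (rule Bochner_Integration.integral_cong) (auto simp: F_def indicator_def)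
      finally show "H x * deriv \<phi> x = (LINT u|lborel. F x u)" .
    qed
    also have "\<dots> = (LINT u|lborel. LINT x|lborel. F x u)"
      using lborel_pair.Fubini_integral[OF iF] by simp
    also have "\<dots> = (LINT u|lborel. - (w u * \<phi> u))"
    proof (rule Bochner_Integration.integral_cong[OF refl])
      fix u
      define R where "R = max u (M + 1)"
      have "u \<le> R" "\<phi> R = 0" using M(2)[of R] M(1) by (auto simp: R_def)
      have "(LINT x|lborel. F x u) = (LINT x|lborel. w u * (deriv \<phi> x * indicator {u..R} x))"
      proof (rule Bochner_Integration.integral_cong[OF refl])
        fix x
        show "F x u = w u * (deriv \<phi> x * indicator {u..R} x)"
          using M(1) M(3)[of x] by (auto simp: F_def R_def indicator_def)
      qed
      also have "\<dots> = w u * (\<phi> R - \<phi> u)"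
        using integral_FTC_Icc_real[OF \<open>u \<le> R\<close>, of \<phi> "deriv \<phi>"] dphi cphi(2)
        by (simp add: continuous_on_eq_continuous_at)
      finally show "(LINT x|lborel. F x u) = - (w u * \<phi> u)"
        using \<open>\<phi> R = 0\<close> by simp
    qed
    finally show ?thesis by simp
  qed
  have "has_dist_diff (\<lambda>y. stein_sol p l y * p y) (of_fun w)"
    unfolding has_dist_diff_def Hprod using liH liw test by (simp add: of_fun_def)
  moreover have "gen_eq (gen_divide (of_fun w) p) (of_fun (\<lambda>x. (l x - expect p l) * indicator (supp p) x))"
    by (auto simp: gen_eq_def gen_divide_def of_fun_def w_def in_supp indicator_def)
  ultimately show ?thesis
    unfolding solves_stein_eq_def has_stein_op_def by blast
qed

text \<open>At an end point of the support \<open>deriv\<close> may be an arbitrary value; this affects only a null set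
  of the regular part.\<close>

definition score :: "(real \<Rightarrow> real) \<Rightarrow> (real \<Rightarrow> real) \<Rightarrow> genfun"
  where "score p q = GenFun (\<lambda>x. deriv p x / p x - deriv q x / q x)
    (\<lambda>c. end_masses (supp p) c * indicator (supp p) c)"

end

theory Submission
  imports Defs
begin

text \<open>Write \<open>c = E\<^sub>p[l]\<close>, \<open>w = (l - c) p\<close> and \<open>H x = \<integral>\<^bsub>u \<le> x\<^esub> w u du\<close>, so that \<open>f p = H\<close> on \<open>S\<close>, and put
  \<open>g = f q = H q / p\<close>. Almost everywhere on the interior \<open>I\<close> of \<open>S\<close> the product rule gives
  \<open>g' = (l - c) q - f (p'/p - q'/q) q\<close>. The integral of the right-hand side is
  \<open>E\<^sub>q[l] - E\<^sub>p[l]\<close> minus the regular part of \<open>E\<^sub>q[f r(p,q)]\<close>, so the claim is that \<open>g'\<close> has integral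
  \<open>0\<close> and that the atoms contribute nothing.

  The atoms are easy: \<open>w\<close> has total integral \<open>0\<close>, hence \<open>H\<close>, and with it \<open>f\<close>, vanishes at each end
  point that belongs to \<open>S\<close> (\<open>stein_sol_at_end\<close>).

  The integral of \<open>g'\<close> is the delicate point. Near the ends of \<open>I\<close>, finite or infinite, \<open>H\<close> tends
  to \<open>0\<close>, but \<open>q / p\<close> may blow up (\<open>p\<close> need not be continuous at an end point that belongs to
  \<open>S\<close>), so the boundedness of \<open>g = H q / p\<close> alone does not make it tend to \<open>0\<close>. It is the
  integrability of \<open>(l - c) q\<close> that excludes boundary terms: since \<open>(l - c) q = g H' / H\<close>, a nonzero
  limit of \<open>g\<close> would make the logarithmic derivative of \<open>H\<close> integrable up to the end point, which
  is impossible as \<open>H\<close> tends to \<open>0\<close>. The lemma \<open>integral_derivative_eq_0\<close> establishes this at both ends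
  at once, by damping \<open>g\<close> with the factor \<open>H\<^sup>2 / (H\<^sup>2 + d)\<close> and letting \<open>d\<close> tend to \<open>0\<close>.

  Two further points need care. \<open>l\<close> is only integrable against \<open>p\<close>, so \<open>H' = w\<close> is an instance of
  Lebesgue's differentiation theorem and holds almost everywhere only. That \<open>H\<close> is nevertheless
  differentiable at every point of \<open>I\<close>, as the fundamental theorem of calculus demands, comes
  from \<open>H = g p / q\<close> and the differentiability of \<open>g\<close>, which is part of \<open>f \<in> F(q)\<close>.\<close>


section \<open>Integrals of derivatives without boundary terms\<close>

text \<open>A zero at which the derivative does not vanish is isolated from all other zeros, and a subset
  of the line without accumulation points in itself is countable, since a countable basis has a
  member for each of its points.\<close>

lemma countable_simple_zeros:
  fixes g :: "real \<Rightarrow> real"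
  assumes Z: "\<And>x. x \<in> Z \<Longrightarrow> g x = 0 \<and> g differentiable (at x) \<and> deriv g x \<noteq> 0"
  shows "countable Z"
proof -
  obtain \<B> :: "real set set" where \<B>: "countable \<B>" "topological_basis \<B>"
    using ex_countable_basis by blast
  have "\<exists>U\<in>\<B>. U \<inter> Z = {x}" if "x \<in> Z" for x
  proof -
    have "(g has_real_derivative deriv g x) (at x)"
      using Z[OF that] by (simp add: DERIV_deriv_iff_real_differentiable)
    then have "((\<lambda>y. (g y - g x) / (y - x)) \<longlongrightarrow> deriv g x) (at x)"
      by (simp add: has_field_derivative_iff)
    then have "eventually (\<lambda>y. (g y - g x) / (y - x) \<noteq> 0) (at x)"
      using Z[OF that] tendsto_imp_eventually_ne by blast
    then obtain V where V: "open V" "x \<in> V" "\<And>y. y \<in> V \<Longrightarrow> y \<noteq> x \<Longrightarrow> g y \<noteq> g x"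
      unfolding eventually_at_topological by auto
    obtain U where "U \<in> \<B>" "x \<in> U" "U \<subseteq> V"
      using topological_basisE[OF \<B>(2) V(1,2)] by blast
    moreover have "y = x" if "y \<in> U" "y \<in> Z" for y
      using V(3)[of y] Z[OF that(2)] Z[OF \<open>x \<in> Z\<close>] that(1) \<open>U \<subseteq> V\<close> by auto
    ultimately show ?thesis using that by blast
  qed
  then obtain U where U: "\<And>x. x \<in> Z \<Longrightarrow> U x \<in> \<B> \<and> U x \<inter> Z = {x}"
    by metis
  then have "inj_on U Z"
    by (metis inj_onI singleton_inject)
  moreover have "U ` Z \<subseteq> \<B>" using U by auto
  ultimately show ?thesis
    using \<B>(1) countable_image_inj_on countable_subset by blast
qed

text \<open>With \<open>\<psi> = H\<^sup>2 / (H\<^sup>2 + d)\<close> one has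
  \<open>(g \<psi>)' = g' \<psi> + g H' \<cdot> 2 H d / (H\<^sup>2 + d)\<^sup>2 = A \<psi> + B \<cdot> 2 H\<^sup>2 d / (H\<^sup>2 + d)\<^sup>2\<close>. Both factors lie between
  \<open>0\<close> and \<open>1\<close>, so \<open>\<bar>A\<bar> + \<bar>B\<bar>\<close> dominates; as \<open>d\<close> tends to \<open>0\<close> the first factor tends to \<open>1\<close> and
  the second to \<open>0\<close> wherever \<open>H \<noteq> 0\<close>. On the zeros of \<open>H\<close> the damped derivative vanishes, but there
  \<open>g\<close> vanishes too, so that \<open>g' = 0\<close> off a countable set. At the ends \<open>g \<psi>\<close> is small because \<open>g\<close> is
  bounded and \<open>\<psi> \<le> H\<^sup>2 / d\<close>.

  Unless \<open>g H'\<close> is the product of \<open>H\<close> and an integrable function, the conclusion can fail: on the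
  interval from \<open>0\<close> to \<open>1\<close> take \<open>g x = x\<close> and \<open>H x = x (1 - x)\<close>.\<close>

lemma integral_derivative_eq_0:
  fixes g H A B :: "real \<Rightarrow> real" and a b :: ereal
  assumes ab: "a < b"
    and dg: "\<And>x. x \<in> einterval a b \<Longrightarrow> g differentiable (at x)"
    and dH: "\<And>x. x \<in> einterval a b \<Longrightarrow> H differentiable (at x)"
    and bdd: "\<And>x. x \<in> einterval a b \<Longrightarrow> \<bar>g x\<bar> \<le> M"
    and zero: "\<And>x. x \<in> einterval a b \<Longrightarrow> H x = 0 \<Longrightarrow> g x = 0"
    and lim_a: "\<And>s. (\<And>n::nat. s n \<in> einterval a b) \<Longrightarrow> (\<lambda>n. ereal (s n)) \<longlonglongrightarrow> a \<Longrightarrow> (\<lambda>n. H (s n)) \<longlonglongrightarrow> 0"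
    and lim_b: "\<And>s. (\<And>n::nat. s n \<in> einterval a b) \<Longrightarrow> (\<lambda>n. ereal (s n)) \<longlonglongrightarrow> b \<Longrightarrow> (\<lambda>n. H (s n)) \<longlonglongrightarrow> 0"
    and A: "AE x in lborel. x \<in> einterval a b \<longrightarrow> deriv g x = A x"
    and B: "AE x in lborel. x \<in> einterval a b \<longrightarrow> g x * deriv H x = H x * B x"
    and iA: "set_integrable lborel (einterval a b) A"
    and iB: "set_integrable lborel (einterval a b) B"
  shows "(LINT x:einterval a b|lborel. A x) = 0"
proof -
  define I where "I = einterval a b"
  note dg = dg[folded I_def] and dH = dH[folded I_def] and bdd = bdd[folded I_def]
    and zero = zero[folded I_def] and A = A[folded I_def] and B = B[folded I_def]
  have I: "open I" and [measurable]: "I \<in> sets borel" by (auto simp: I_def)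
  have Dg: "(g has_real_derivative deriv g x) (at x)" if "x \<in> I" for x
    using dg[OF that] by (simp add: DERIV_deriv_iff_real_differentiable)
  have DH: "(H has_real_derivative deriv H x) (at x)" if "x \<in> I" for x
    using dH[OF that] by (simp add: DERIV_deriv_iff_real_differentiable)
  obtain t s :: "nat \<Rightarrow> real" where Ist: "I = (\<Union>i. {s i..t i})"
    and mono: "incseq t" "decseq s" and st: "\<And>i. s i < t i"
    and lims: "\<And>i. a < s i" "\<And>i. t i < b" "s \<longlonglongrightarrow> a" "t \<longlonglongrightarrow> b"
    by (rule einterval_Icc_approximation[OF ab, folded I_def]) (rule that)
  have sub: "{s n..t n} \<subseteq> I" for n using Ist by auto
  have sI: "s n \<in> I" and tI: "t n \<in> I" for n using sub[of n] st[of n] by auto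
  have Hs: "(\<lambda>n. H (s n)) \<longlonglongrightarrow> 0" and Ht: "(\<lambda>n. H (t n)) \<longlonglongrightarrow> 0"
    using lim_a[of s] lim_b[of t] lims sI tI by (auto simp: I_def)
  \<comment> \<open>Chosen positive, tending to \<open>0\<close>, and not smaller than \<open>H\<close> at the two ends, so that \<open>\<psi> \<le> H\<^sup>2 / d \<le> \<bar>H\<bar>\<close>
    there: a single index then handles both the boundary terms and the limit of \<open>\<psi>\<close>.\<close>
  define d where "d n = \<bar>H (s n)\<bar> + \<bar>H (t n)\<bar> + 1 / real (Suc n)" for n
  have dpos: "d n > 0" for n
    unfolding d_def by (intro add_nonneg_pos) auto
  have "d \<longlonglongrightarrow> \<bar>0\<bar> + \<bar>0\<bar> + 0"
    unfolding d_def by (intro tendsto_intros Hs Ht LIMSEQ_Suc[OF lim_1_over_n])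
  then have d0: "d \<longlonglongrightarrow> 0" by simp
  define \<psi> where "\<psi> n x = (H x)\<^sup>2 / ((H x)\<^sup>2 + d n)" for n x
  define \<kappa> where "\<kappa> n x = 2 * (H x)\<^sup>2 * d n / ((H x)\<^sup>2 + d n)\<^sup>2" for n x
  define F where "F n x = A x * \<psi> n x + B x * \<kappa> n x" for n x
  have den: "(H x)\<^sup>2 + d n > 0" for n x
    using dpos[of n] by (simp add: add_nonneg_pos)
  have \<psi>01: "0 \<le> \<psi> n x" "\<psi> n x \<le> 1" for n x
    using den[of x n] dpos[of n] by (auto simp: \<psi>_def divide_simps)
  have \<kappa>01: "0 \<le> \<kappa> n x" "\<kappa> n x \<le> 1" for n x
  proof -
    have "2 * (H x)\<^sup>2 * d n \<le> ((H x)\<^sup>2 + d n)\<^sup>2"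
      by (simp add: power2_sum)
    then show "\<kappa> n x \<le> 1" unfolding \<kappa>_def using den[of x n] by (simp add: divide_simps)
    show "0 \<le> \<kappa> n x" unfolding \<kappa>_def using dpos[of n] by simp
  qed
  have D\<psi>: "(\<psi> n has_real_derivative deriv H x * (2 * H x * d n / ((H x)\<^sup>2 + d n)\<^sup>2)) (at x)"
    if "x \<in> I" for n x
  proof -
    have "(\<psi> n has_real_derivative (2 * H x * deriv H x * ((H x)\<^sup>2 + d n) - (H x)\<^sup>2 * (2 * H x * deriv H x))
        / (((H x)\<^sup>2 + d n) * ((H x)\<^sup>2 + d n))) (at x)"
      unfolding \<psi>_def using den[of x n] by (auto intro!: derivative_eq_intros DH[OF that])
    moreover have "2 * H x * deriv H x * ((H x)\<^sup>2 + d n) - (H x)\<^sup>2 * (2 * H x * deriv H x) = deriv H x * (2 * H x * d n)"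
      by (simp add: algebra_simps)
    ultimately show ?thesis by (simp add: power2_eq_square[of "(H x)\<^sup>2 + d n"])
  qed
  have D: "((\<lambda>y. g y * \<psi> n y) has_real_derivative
      deriv g x * \<psi> n x + g x * deriv H x * (2 * H x * d n / ((H x)\<^sup>2 + d n)\<^sup>2)) (at x)"
    if "x \<in> I" for n x
    using DERIV_mult[OF Dg[OF that] D\<psi>[OF that, of n]] by (simp add: mult_ac)
  have FTC: "(F n has_integral (g (t n) * \<psi> n (t n) - g (s n) * \<psi> n (s n))) {s n..t n}" for n
  proof -
    have I1: "((\<lambda>x. deriv g x * \<psi> n x + g x * deriv H x * (2 * H x * d n / ((H x)\<^sup>2 + d n)\<^sup>2))
        has_integral (g (t n) * \<psi> n (t n) - g (s n) * \<psi> n (s n))) {s n..t n}"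
    proof (rule fundamental_theorem_of_calculus[OF less_imp_le[OF st]])
      fix x assume "x \<in> {s n..t n}"
      then have "x \<in> I" using sub by blast
      from has_field_derivative_at_within[OF D[OF this]]
      show "((\<lambda>y. g y * \<psi> n y) has_vector_derivative
          deriv g x * \<psi> n x + g x * deriv H x * (2 * H x * d n / ((H x)\<^sup>2 + d n)\<^sup>2)) (at x within {s n..t n})"
        by (simp only: has_real_derivative_iff_has_vector_derivative)
    qed
    have ae: "AE x in lborel. x \<in> {s n..t n} \<longrightarrow>
        deriv g x * \<psi> n x + g x * deriv H x * (2 * H x * d n / ((H x)\<^sup>2 + d n)\<^sup>2) = F n x"
      using A B
    proof eventually_elim
      case (elim x)
      show ?case
      proof
        assume "x \<in> {s n..t n}"
        then have "x \<in> I" using sub by blast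
        then show "deriv g x * \<psi> n x + g x * deriv H x * (2 * H x * d n / ((H x)\<^sup>2 + d n)\<^sup>2) = F n x"
          using elim by (simp add: F_def \<kappa>_def power2_eq_square)
      qed
    qed
    show ?thesis using I1 unfolding has_integral_AE[OF ae] .
  qed
  have mA[measurable]: "(\<lambda>x. indicator I x * A x) \<in> borel_measurable borel"
    and mB[measurable]: "(\<lambda>x. indicator I x * B x) \<in> borel_measurable borel"
    using iA iB unfolding I_def[symmetric] set_integrable_def by (auto dest: borel_measurable_integrable)
  have "continuous_on I H"
    using DH DERIV_isCont by (blast intro: continuous_at_imp_continuous_on)
  then have mH[measurable]: "(\<lambda>x. indicator I x * H x) \<in> borel_measurable borel"
    using borel_measurable_continuous_on_indicator[of I H] by simp
  \<comment> \<open>Multiplication by the indicator of \<open>I\<close> makes each ingredient measurable on the whole line.\<close>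
  have mF: "(\<lambda>x. indicator {s n..t n} x * F n x) \<in> borel_measurable borel" for n
  proof -
    have "(\<lambda>x. indicator {s n..t n} x * F n x) = (\<lambda>x. indicator {s n..t n} x *
        ((indicator I x * A x) * ((indicator I x * H x)\<^sup>2 / ((indicator I x * H x)\<^sup>2 + d n)) +
         (indicator I x * B x) * (2 * (indicator I x * H x)\<^sup>2 * d n / ((indicator I x * H x)\<^sup>2 + d n)\<^sup>2)))"
      using sub[of n] by (auto simp: fun_eq_iff indicator_def F_def \<psi>_def \<kappa>_def)
    also have "\<dots> \<in> borel_measurable borel" by measurable
    finally show ?thesis .
  qed
  have bound: "norm (indicator {s n..t n} x * F n x) \<le> indicator I x * \<bar>A x\<bar> + indicator I x * \<bar>B x\<bar>" for n x
  proof (cases "x \<in> {s n..t n}")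
    case True
    have "\<bar>F n x\<bar> \<le> \<bar>A x\<bar> * \<psi> n x + \<bar>B x\<bar> * \<kappa> n x"
      unfolding F_def using \<psi>01[of n x] \<kappa>01[of n x]
      by (intro order_trans[OF abs_triangle_ineq]) (simp add: abs_mult)
    also have "\<dots> \<le> \<bar>A x\<bar> * 1 + \<bar>B x\<bar> * 1"
      using \<psi>01[of n x] \<kappa>01[of n x] by (intro add_mono mult_left_mono) auto
    finally show ?thesis using True sub[of n] by (auto simp: indicator_def)
  qed (auto simp: indicator_def)
  have iW: "integrable lborel (\<lambda>x. indicator I x * \<bar>A x\<bar> + indicator I x * \<bar>B x\<bar>)"
    using set_integrable_abs[OF iA] set_integrable_abs[OF iB]
    unfolding I_def[symmetric] set_integrable_def by simp
  have iF: "integrable lborel (\<lambda>x. indicator {s n..t n} x * F n x)" for n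
    by (rule Bochner_Integration.integrable_bound[OF iW]) (use mF bound in \<open>auto intro: order_trans[OF _ abs_ge_self]\<close>)
  have int: "(LINT x|lborel. indicator {s n..t n} x * F n x) = g (t n) * \<psi> n (t n) - g (s n) * \<psi> n (s n)" for n
    using set_borel_integral_eq_integral(2)[of "{s n..t n}" "F n"] iF[of n] FTC[of n]
    by (simp add: set_integrable_def set_lebesgue_integral_def integral_unique)
  have "countable {x \<in> I. g x = 0 \<and> deriv g x \<noteq> 0}"
    using dg by (intro countable_simple_zeros[of _ g]) auto
  then have "AE x in lborel. x \<notin> {x \<in> I. g x = 0 \<and> deriv g x \<noteq> 0}"
    by (intro AE_not_in countable_imp_null_set_lborel)
  then have conv: "AE x in lborel. (\<lambda>n. indicator {s n..t n} x * F n x) \<longlonglongrightarrow> indicator I x * A x"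
    using A
  proof eventually_elim
    case (elim x)
    show ?case
    proof (cases "x \<in> I")
      case False
      then have "x \<notin> {s n..t n}" for n using sub by blast
      then show ?thesis using False by simp
    next
      case True
      then obtain N where N: "x \<in> {s N..t N}" using Ist by auto
      have "x \<in> {s n..t n}" if "n \<ge> N" for n
        using N decseqD[OF mono(2) that] incseqD[OF mono(1) that] by auto
      then have ev: "eventually (\<lambda>n. F n x = indicator {s n..t n} x * F n x) sequentially"
        by (intro eventually_sequentiallyI[of N]) auto
      have "(\<lambda>n. F n x) \<longlonglongrightarrow> A x"
      proof (cases "H x = 0")
        case True
        then have "A x = 0" using zero[OF \<open>x \<in> I\<close>] elim \<open>x \<in> I\<close> by auto
        then show ?thesis using True by (simp add: F_def \<psi>_def \<kappa>_def)
      next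
        case False
        have "(\<lambda>n. F n x) \<longlonglongrightarrow> A x * ((H x)\<^sup>2 / ((H x)\<^sup>2 + 0)) + B x * (2 * (H x)\<^sup>2 * 0 / ((H x)\<^sup>2 + 0)\<^sup>2)"
          unfolding F_def \<psi>_def \<kappa>_def using False by (intro tendsto_intros d0) auto
        then show ?thesis using False by simp
      qed
      then show ?thesis using True tendsto_cong[OF ev] by simp
    qed
  qed
  have "(\<lambda>n. LINT x|lborel. indicator {s n..t n} x * F n x) \<longlonglongrightarrow> (LINT x|lborel. indicator I x * A x)"
    by (rule integral_dominated_convergence[OF _ _ iW conv]) (use mA mF bound in auto)
  moreover have "(\<lambda>n. g (t n) * \<psi> n (t n) - g (s n) * \<psi> n (s n)) \<longlonglongrightarrow> 0"
  proof -
    have est: "\<bar>g x * \<psi> n x\<bar> \<le> M * \<bar>H x\<bar>" if "x \<in> I" "\<bar>H x\<bar> \<le> d n" for x n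
    proof -
      have "\<bar>H x\<bar> * \<bar>H x\<bar> \<le> \<bar>H x\<bar> * ((H x)\<^sup>2 + d n)"
        using that(2) by (intro mult_left_mono) (auto intro: order_trans)
      then have "\<psi> n x \<le> \<bar>H x\<bar>"
        unfolding \<psi>_def using den[of x n] by (simp add: divide_le_eq power2_eq_square)
      then show ?thesis
        using bdd[OF that(1)] \<psi>01[of n x] by (auto simp: abs_mult intro!: mult_mono)
    qed
    have lim0: "(\<lambda>n. M * \<bar>H (t n)\<bar>) \<longlonglongrightarrow> 0" "(\<lambda>n. M * \<bar>H (s n)\<bar>) \<longlonglongrightarrow> 0"
      using tendsto_mult_right_zero[OF tendsto_rabs_zero[OF Ht]] tendsto_mult_right_zero[OF tendsto_rabs_zero[OF Hs]] by auto
    have le: "norm (g (t n) * \<psi> n (t n)) \<le> M * \<bar>H (t n)\<bar>" "norm (g (s n) * \<psi> n (s n)) \<le> M * \<bar>H (s n)\<bar>" for n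
      using est[OF tI, of n n] est[OF sI, of n n] by (auto simp: d_def)
    have "(\<lambda>n. g (t n) * \<psi> n (t n)) \<longlonglongrightarrow> 0"
      by (rule Lim_null_comparison[OF always_eventually lim0(1)]) (use le in blast)
    moreover have "(\<lambda>n. g (s n) * \<psi> n (s n)) \<longlonglongrightarrow> 0"
      by (rule Lim_null_comparison[OF always_eventually lim0(2)]) (use le in blast)
    ultimately show ?thesis using tendsto_diff[of _ 0 sequentially _ 0] by fastforce
  qed
  ultimately have "(LINT x|lborel. indicator I x * A x) = 0"
    unfolding int using LIMSEQ_unique by blast
  then show ?thesis by (simp add: I_def set_lebesgue_integral_def)
qed


section \<open>Primitives\<close>

text \<open>By Lebesgue's differentiation theorem the right-hand difference quotients of the primitive
  converge to \<open>w\<close> almost everywhere; where the derivative exists, it is their limit.\<close>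

lemma AE_derivative_indefinite_integral:
  fixes w H :: "real \<Rightarrow> real"
  assumes w: "integrable lborel w"
  shows "AE x in lborel. (\<lambda>x. LINT u:{..x}|lborel. w u) differentiable (at x) \<longrightarrow>
    deriv (\<lambda>x. LINT u:{..x}|lborel. w u) x = w x"
proof -
  define H where "H x = (LINT u:{..x}|lborel. w u)" for x
  have iw: "set_integrable lborel X w" if "X \<in> sets borel" for X
    using integrable_mult_indicator[OF _ w, of X] that by (simp add: set_integrable_def)
  have "w integrable_on cbox x y" for x y
    using set_borel_integral_eq_integral(1)[OF iw] by simp
  then obtain N where N: "negligible N" "\<And>x e. \<lbrakk>x \<notin> N; 0 < e\<rbrakk> \<Longrightarrow>
      \<exists>d>0. \<forall>h. 0 < h \<and> h < d \<longrightarrow> norm (integral (cbox x (x + h *\<^sub>R One)) w /\<^sub>R h ^ DIM(real) - w x) < e"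
    using integrable_ccontinuous_explicit[of w] by blast
  have inc: "integral {x..x + h} w = H (x + h) - H x" if "h > 0" for x h
  proof -
    have "{..x + h} = {..x} \<union> {x<..x + h}" using that by auto
    then have "H (x + h) = H x + (LINT u:{x<..x + h}|lborel. w u)"
      unfolding H_def using set_integral_Un[OF _ iw iw, of "{..x}" "{x<..x + h}"] by force
    moreover have "(LINT u:{x<..x + h}|lborel. w u) = (LINT u:{x..x + h}|lborel. w u)"
      unfolding set_lebesgue_integral_def using AE_lborel_singleton[of x] borel_measurable_integrable[OF w]
      by (intro integral_cong_AE) (auto simp: indicator_def elim!: eventually_mono)
    ultimately show ?thesis
      using set_borel_integral_eq_integral(2)[OF iw[of "{x..x + h}"]] by simp
  qed
  have "deriv H x = w x" if x: "x \<notin> N" and "H differentiable (at x)" for x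
  proof (rule tendsto_unique)
    have "((\<lambda>h. (H (x + h) - H x) / h) \<longlongrightarrow> deriv H x) (at 0)"
      using that(2) by (simp add: DERIV_deriv_iff_real_differentiable[symmetric] DERIV_def)
    then show "((\<lambda>h. (H (x + h) - H x) / h) \<longlongrightarrow> deriv H x) (at_right 0)"
      by (rule tendsto_within_subset) simp
    show "((\<lambda>h. (H (x + h) - H x) / h) \<longlongrightarrow> w x) (at_right 0)"
    proof (rule tendstoI)
      fix e :: real assume "e > 0"
      then obtain d where d: "d > 0"
        "\<And>h. 0 < h \<Longrightarrow> h < d \<Longrightarrow> norm (integral (cbox x (x + h *\<^sub>R One)) w /\<^sub>R h ^ DIM(real) - w x) < e"
        using N(2)[OF x] by blast
      have "dist ((H (x + h) - H x) / h) (w x) < e" if "0 < h" "h < d" for h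
        using d(2)[OF that] inc[OF that(1)] by (simp add: dist_norm divide_inverse_commute)
      then show "\<forall>\<^sub>F h in at_right 0. dist ((H (x + h) - H x) / h) (w x) < e"
        using d(1) unfolding eventually_at_right_field by blast
    qed
  qed simp
  moreover have "AE x in lebesgue. x \<notin> N"
    using N(1) by (intro AE_not_in) (simp add: negligible_iff_null_sets)
  then have "AE x in lborel. x \<notin> N"
    by (simp add: AE_completion_iff)
  ultimately show ?thesis unfolding H_def[symmetric] by (auto elim!: eventually_mono)
qed



section \<open>Intervals and their end points\<close>

lemma interior_interval_eq_einterval:
  assumes S: "is_interval S"
  shows "interior S = einterval (left_end S) (right_end S)"
proof
  show "einterval (left_end S) (right_end S) \<subseteq> interior S"
  proof (rule interior_maximal)
    show "einterval (left_end S) (right_end S) \<subseteq> S"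
    proof
      fix x assume "x \<in> einterval (left_end S) (right_end S)"
      then have x: "left_end S < ereal x" "ereal x < right_end S"
        by (auto simp: einterval_def)
      obtain y where "y \<in> S" "y < x"
        using x(1) unfolding left_end_def INF_less_iff by auto
      moreover obtain z where "z \<in> S" "x < z"
        using x(2) unfolding right_end_def less_SUP_iff by auto
      ultimately show "x \<in> S"
        using S unfolding is_interval_1 by (meson less_imp_le)
    qed
  qed simp
  show "interior S \<subseteq> einterval (left_end S) (right_end S)"
  proof
    fix x assume "x \<in> interior S"
    then obtain e where e: "e > 0" "cball x e \<subseteq> S"
      by (auto simp: mem_interior_cball)
    then have "x - e \<in> S" "x + e \<in> S"
      by (auto simp: dist_real_def)
    then have "left_end S \<le> ereal (x - e)" "ereal (x + e) \<le> right_end S"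
      unfolding left_end_def right_end_def by (auto intro: INF_lower SUP_upper)
    moreover have "ereal (x - e) < ereal x" "ereal x < ereal (x + e)"
      using e(1) by auto
    ultimately show "x \<in> einterval (left_end S) (right_end S)"
      unfolding einterval_def by (blast intro: le_less_trans less_le_trans)
  qed
qed

lemma AE_interior_or_outside_interval:
  fixes S :: "real set"
  assumes "is_interval S"
  shows "AE x in lborel. x \<in> interior S \<or> x \<notin> S"
proof -
  have "negligible (frontier S)"
    using assms by (simp add: negligible_convex_frontier is_interval_convex_1)
  then have "AE x in lebesgue. x \<notin> frontier S"
    by (intro AE_not_in) (simp add: negligible_iff_null_sets)
  then have "AE x in lborel. x \<notin> frontier S"
    by (simp add: AE_completion_iff)
  then show ?thesis
    by eventually_elim (use closure_subset in \<open>auto simp: frontier_def\<close>)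
qed
text \<open>By dominated convergence the primitive tends to \<open>0\<close> at the left end and to the total integral,
  which is \<open>0\<close>, at the right end. The sequence may lie anywhere, so that a constant sequence gives the
  value of the primitive at a finite end point.\<close>

lemma tendsto_centred_primitive_at_end:
  fixes w :: "real \<Rightarrow> real" and s :: "nat \<Rightarrow> real"
  assumes w: "integrable lborel w" and w0: "(LINT u|lborel. w u) = 0"
    and out: "AE u in lborel. u \<in> einterval a b \<or> w u = 0"
    and s: "(\<lambda>n. ereal (s n)) \<longlonglongrightarrow> a \<or> (\<lambda>n. ereal (s n)) \<longlonglongrightarrow> b"
  shows "(\<lambda>n. LINT u:{..s n}|lborel. w u) \<longlonglongrightarrow> 0"
proof -
  have wm[measurable]: "w \<in> borel_measurable borel"
    using w by auto
  have dom: "(\<lambda>n. LINT u|lborel. indicator {..s n} u * w u) \<longlonglongrightarrow> (LINT u|lborel. v u)"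
    if "AE u in lborel. (\<lambda>n. indicator {..s n} u * w u) \<longlonglongrightarrow> v u" "v \<in> borel_measurable borel" for v
    by (rule integral_dominated_convergence[OF _ _ integrable_abs[OF w] that(1)])
       (use that(2) in \<open>auto simp: indicator_def\<close>)
  from s show ?thesis
  proof
    assume s: "(\<lambda>n. ereal (s n)) \<longlonglongrightarrow> a"
    have "AE u in lborel. (\<lambda>n. indicator {..s n} u * w u) \<longlonglongrightarrow> 0"
      using out
    proof eventually_elim
      case (elim u)
      show ?case
      proof (cases "w u = 0")
        case False
        then have "a < ereal u" using elim by (auto simp: einterval_def)
        then have "eventually (\<lambda>n. ereal (s n) < ereal u) sequentially"
          using order_tendstoD(2)[OF s] by blast
        then have "eventually (\<lambda>n. indicator {..s n} u * w u = 0) sequentially"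
          by eventually_elim auto
        then show ?thesis by (rule tendsto_eventually)
      qed simp
    qed
    then show ?thesis using dom[of "\<lambda>_. 0"] by (simp add: set_lebesgue_integral_def)
  next
    assume s: "(\<lambda>n. ereal (s n)) \<longlonglongrightarrow> b"
    have "AE u in lborel. (\<lambda>n. indicator {..s n} u * w u) \<longlonglongrightarrow> w u"
      using out
    proof eventually_elim
      case (elim u)
      show ?case
      proof (cases "w u = 0")
        case False
        then have "ereal u < b" using elim by (auto simp: einterval_def)
        then have "eventually (\<lambda>n. ereal u < ereal (s n)) sequentially"
          using order_tendstoD(1)[OF s] by blast
        then have "eventually (\<lambda>n. indicator {..s n} u * w u = w u) sequentially"
          by eventually_elim auto
        then show ?thesis by (rule tendsto_eventually)
      qed simp
    qed
    then show ?thesis using dom[of w] w0 by (simp add: set_lebesgue_integral_def)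
  qed
qed


section \<open>The solution of the Stein equation\<close>

lemma centred_integral_eq_0:
  assumes p: "p \<in> class_G" and l: "has_expect p l"
  shows "integrable lborel (\<lambda>u. (l u - expect p l) * p u)"
    and "(LINT u|lborel. (l u - expect p l) * p u) = 0"
proof -
  have i: "integrable lborel (\<lambda>u. l u * p u)" "integrable lborel p" "(LINT u|lborel. p u) = 1"
    using p l by (auto simp: has_expect_def class_G_def)
  then show "integrable lborel (\<lambda>u. (l u - expect p l) * p u)"
    by (simp add: left_diff_distrib)
  show "(LINT u|lborel. (l u - expect p l) * p u) = 0"
    using i by (simp add: left_diff_distrib Bochner_Integration.integral_diff expect_def)
qed

text \<open>The defining integral starts at the left end point of the support; it may as well start at
  \<open>-\<infinity>\<close>, as \<open>p\<close> vanishes in between.\<close>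

lemma stein_sol_times_density:
  assumes p: "p \<in> class_G" and l: "has_expect p l" and x: "x \<in> supp p"
  shows "stein_sol p l x * p x = (LINT u:{..x}|lborel. (l u - expect p l) * p u)"
proof -
  define w where "w u = (l u - expect p l) * p u" for u
  define a where "a = left_end (supp p)"
  have [measurable]: "w \<in> borel_measurable borel"
    using centred_integral_eq_0(1)[OF p l] by (auto simp: w_def[abs_def])
  have ax: "a \<le> ereal u" if "u \<in> supp p" for u
    unfolding a_def left_end_def using that by (auto intro: INF_lower)
  have "AE u in lborel. indicator (einterval a (ereal x)) u *\<^sub>R w u = indicator {..x} u *\<^sub>R w u"
    using AE_lborel_singleton[of x] AE_lborel_singleton[of "real_of_ereal a"]
  proof eventually_elim
    case (elim u)
    show ?case
    proof (cases "w u = 0 \<or> x < u")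
      case True
      then show ?thesis by (auto simp: indicator_def einterval_def)
    next
      case False
      then have "u \<in> supp p" by (auto simp: w_def support_on_def)
      then have "a \<le> ereal u" "a \<noteq> ereal u" "u < x" using ax False elim by auto
      then show ?thesis by (auto simp: indicator_def einterval_def)
    qed
  qed
  then have "(LINT u|lborel. indicator (einterval a (ereal x)) u *\<^sub>R w u) = (LINT u:{..x}|lborel. w u)"
    unfolding set_lebesgue_integral_def by (intro integral_cong_AE) auto
  then have "(LBINT u=a..ereal x. w u) = (LINT u:{..x}|lborel. w u)"
    using ax[OF x] by (simp add: interval_lebesgue_integral_def set_lebesgue_integral_def)
  then show ?thesis
    using x by (simp add: stein_sol_def w_def a_def support_on_def)
qed


text \<open>The value at an end point is the limit of the primitive along a constant sequence, hence \<open>0\<close>. The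
  coefficients of \<open>f r(p,q)\<close> at its Dirac masses are \<open>\<plusminus> f\<close> at such points.\<close>

lemma stein_sol_at_end:
  assumes p: "p \<in> class_G" and l: "has_expect p l" and x: "x \<in> supp p"
    and e: "ereal x = left_end (supp p) \<or> ereal x = right_end (supp p)"
  shows "stein_sol p l x = 0"
proof -
  define w where "w u = (l u - expect p l) * p u" for u
  have iS: "is_interval (supp p)" using p by (simp add: class_G_def)
  have "AE u in lborel. u \<in> einterval (left_end (supp p)) (right_end (supp p)) \<or> w u = 0"
    using AE_interior_or_outside_interval[OF iS]
    unfolding interior_interval_eq_einterval[OF iS]
  proof eventually_elim
    case (elim u)
    then show ?case by (cases "p u = 0") (simp_all add: w_def support_on_def)
  qed
  moreover have "(\<lambda>n::nat. ereal x) \<longlonglongrightarrow> left_end (supp p) \<or> (\<lambda>n::nat. ereal x) \<longlonglongrightarrow> right_end (supp p)"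
    using e by auto
  ultimately have "(\<lambda>n::nat. LINT u:{..x}|lborel. w u) \<longlonglongrightarrow> 0"
    using centred_integral_eq_0[OF p l, folded w_def] by (intro tendsto_centred_primitive_at_end)
  then have "(LINT u:{..x}|lborel. w u) = 0"
    by (simp add: tendsto_const_iff)
  then show ?thesis
    using stein_sol_times_density[OF p l x] x by (simp add: w_def support_on_def)
qed


section \<open>The comparison of expectations\<close>

theorem theorem2p3:
  fixes p q l f :: "real \<Rightarrow> real" and S :: "real set"
  assumes "p \<in> class_G" and "q \<in> class_G"
    and "supp p = S" and "supp q = S"
    and "has_expect p l" and "has_expect q l"
    and "f = stein_sol p l" and "solves_stein_eq p l f"
    and "f \<in> class_F q"
    and "has_gen_expect q (gen_mult f (score p q))"
  shows "expect q l - expect p l = gen_expect q (gen_mult f (score p q))"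
proof -
  note pG = assms(1) and qG = assms(2) and Sp = assms(3) and Sq = assms(4)
    and lp = assms(5) and lq = assms(6) and f = assms(7) and fF = assms(9)
  define c where "c = expect p l"
  define w where "w u = (l u - c) * p u" for u
  define H where "H x = (LINT u:{..x}|lborel. w u)" for x
  define g where "g x = f x * q x" for x
  define R where "R x = f x * (deriv p x / p x - deriv q x / q x) * q x" for x
  define B where "B x = (l x - c) * q x" for x
  define a b where "a = left_end S" and "b = right_end S"
  have iS: "is_interval S" using pG Sp by (auto simp: class_G_def)
  have intS: "interior S = einterval a b"
    using interior_interval_eq_einterval[OF iS] by (simp add: a_def b_def)
  have in_S: "x \<in> S \<longleftrightarrow> p x \<noteq> 0" "x \<in> S \<longleftrightarrow> q x \<noteq> 0" for x
    using Sp Sq by (auto simp: support_on_def)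
  have ae_S: "AE x in lborel. x \<in> einterval a b \<or> x \<notin> S"
    using AE_interior_or_outside_interval[OF iS] intS by simp
  have iw: "integrable lborel w" and w0: "(LINT u|lborel. w u) = 0"
    using centred_integral_eq_0[OF pG lp] by (auto simp: w_def[abs_def] c_def)
  have out: "AE u in lborel. u \<in> einterval a b \<or> w u = 0"
    using ae_S by eventually_elim (auto simp: w_def in_S)
  have fH: "f x * p x = H x" if "x \<in> S" for x
    using stein_sol_times_density[OF pG lp] that by (simp add: f Sp H_def w_def c_def)
  have ISx: "x \<in> S" if "x \<in> einterval a b" for x
    using that intS interior_subset by blast
  \<comment> \<open>Otherwise the interior of \<open>S\<close> is empty, so \<open>p\<close> vanishes almost everywhere.\<close>
  have ab: "a < b"
  proof (rule ccontr)
    assume "\<not> a < b"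
    then have "einterval a b = {}" by (auto simp: einterval_def)
    then have "AE x in lborel. p x = 0" using ae_S in_S by auto
    then have "(LINT x|lborel. p x) = 0"
      using integral_eq_zero_AE by blast
    then show False using pG by (simp add: class_G_def)
  qed
  have dp: "(p has_real_derivative deriv p x) (at x)" and dq: "(q has_real_derivative deriv q x) (at x)"
    if "x \<in> einterval a b" for x
    using that pG qG Sp Sq intS by (auto simp: class_G_def DERIV_deriv_iff_real_differentiable)
  have dg: "g differentiable (at x)" if "x \<in> einterval a b" for x
    using fF that Sq intS by (auto simp: class_F_def g_def[abs_def])
  have Hg: "H x = g x * p x / q x" if "x \<in> einterval a b" for x
    using fH[OF ISx[OF that]] ISx[OF that] in_S by (simp add: g_def)
  have gH: "g x = H x * q x / p x" if "x \<in> einterval a b" for x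
    using fH[OF ISx[OF that]] ISx[OF that] in_S by (simp add: g_def fH[symmetric])
  have nbh: "eventually (\<lambda>y. y \<in> einterval a b) (nhds x)" if "x \<in> einterval a b" for x
    using that by (simp add: eventually_nhds_in_open)
  \<comment> \<open>\<open>H\<close> is differentiable at every point because \<open>g p / q\<close> is, although its derivative is known to be
    \<open>w\<close> only almost everywhere.\<close>
  have dH: "H differentiable (at x)" if x: "x \<in> einterval a b" for x
  proof -
    have D: "((\<lambda>y. g y * p y / q y) has_real_derivative
        ((deriv g x * p x + deriv p x * g x) * q x - g x * p x * deriv q x) / (q x * q x)) (at x)"
      using dg[OF x] dp[OF x] dq[OF x] ISx[OF x] in_S
      by (intro DERIV_divide DERIV_mult) (auto simp: DERIV_deriv_iff_real_differentiable)
    have ev: "eventually (\<lambda>y. H y = g y * p y / q y) (nhds x)"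
      using nbh[OF x] by eventually_elim (rule Hg)
    have "(H has_real_derivative
        ((deriv g x * p x + deriv p x * g x) * q x - g x * p x * deriv q x) / (q x * q x)) (at x)"
      using D by (simp only: DERIV_cong_ev[OF refl ev refl])
    then show ?thesis using real_differentiable_def by blast
  qed
  have ae_H: "AE x in lborel. x \<in> einterval a b \<longrightarrow> deriv H x = w x"
    using AE_derivative_indefinite_integral[OF iw] unfolding H_def[symmetric]
    by eventually_elim (use dH in blast)
  have ae_g: "AE x in lborel. x \<in> einterval a b \<longrightarrow> deriv g x = B x - R x"
    using ae_H
  proof eventually_elim
    case (elim x)
    show ?case
    proof
      assume x: "x \<in> einterval a b"
      have nz: "p x \<noteq> 0" "q x \<noteq> 0" using ISx[OF x] in_S by auto
      have "(H has_real_derivative w x) (at x)"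
        using dH[OF x] elim x by (metis DERIV_deriv_iff_real_differentiable)
      then have D: "((\<lambda>y. H y * q y / p y) has_real_derivative
          ((w x * q x + deriv q x * H x) * p x - H x * q x * deriv p x) / (p x * p x)) (at x)"
        using dp[OF x] dq[OF x] nz by (intro DERIV_divide DERIV_mult)
      have ev: "eventually (\<lambda>y. g y = H y * q y / p y) (nhds x)"
        using nbh[OF x] by eventually_elim (rule gH)
      have "deriv g x = ((w x * q x + deriv q x * H x) * p x - H x * q x * deriv p x) / (p x * p x)"
        using D by (intro DERIV_imp_deriv) (simp only: DERIV_cong_ev[OF refl ev refl])
      also have "\<dots> = B x - R x"
        unfolding fH[OF ISx[OF x], symmetric] using nz by (simp add: w_def B_def R_def field_simps)
      finally show "deriv g x = B x - R x" .
    qed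
  qed
  have ae_gH: "AE x in lborel. x \<in> einterval a b \<longrightarrow> g x * deriv H x = H x * B x"
    using ae_H
  proof eventually_elim
    case (elim x)
    then show ?case using fH[OF ISx, of x] by (auto simp: g_def B_def w_def)
  qed
  have "\<exists>M. \<forall>x. \<bar>g x\<bar> \<le> M"
    using fF by (auto simp: class_F_def g_def bounded_iff)
  then obtain M where M: "\<And>x. \<bar>g x\<bar> \<le> M" by blast
  have iB: "integrable lborel B" and intB: "(LINT x|lborel. B x) = expect q l - c"
  proof -
    have i: "integrable lborel (\<lambda>x. l x * q x)" "integrable lborel q" "(LINT x|lborel. q x) = 1"
      using lq qG by (auto simp: has_expect_def class_G_def)
    then show "integrable lborel B" by (simp add: B_def[abs_def] left_diff_distrib)
    show "(LINT x|lborel. B x) = expect q l - c"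
      using i by (simp add: B_def left_diff_distrib Bochner_Integration.integral_diff expect_def)
  qed
  have iR: "integrable lborel R"
    using assms(10) by (simp add: has_gen_expect_def has_expect_def gen_mult_def score_def R_def[abs_def])
  have iA: "integrable lborel (\<lambda>x. B x - R x)" using iB iR by simp
  have si: "set_integrable lborel (einterval a b) h" if "integrable lborel h" for h :: "real \<Rightarrow> real"
    using integrable_mult_indicator[OF _ that] by (simp add: set_integrable_def)
  have "(LINT x:einterval a b|lborel. B x - R x) = 0"
  proof (rule integral_derivative_eq_0[OF ab dg dH M])
    show "g x = 0" if "x \<in> einterval a b" "H x = 0" for x using gH that by simp
    show "(\<lambda>n. H (s n)) \<longlonglongrightarrow> 0" if "(\<lambda>n. ereal (s n)) \<longlonglongrightarrow> a" for s :: "nat \<Rightarrow> real"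
      unfolding H_def using tendsto_centred_primitive_at_end[OF iw w0 out] that by blast
    show "(\<lambda>n. H (s n)) \<longlonglongrightarrow> 0" if "(\<lambda>n. ereal (s n)) \<longlonglongrightarrow> b" for s :: "nat \<Rightarrow> real"
      unfolding H_def using tendsto_centred_primitive_at_end[OF iw w0 out] that by blast
  qed (use ae_g ae_gH si iA iB in auto)
  moreover have "(LINT x:einterval a b|lborel. B x - R x) = (LINT x|lborel. B x - R x)"
    unfolding set_lebesgue_integral_def
  proof (rule integral_cong_AE)
    show "AE x in lborel. indicator (einterval a b) x *\<^sub>R (B x - R x) = B x - R x"
      using ae_S
    proof eventually_elim
      case (elim x)
      then show ?case by (cases "x \<in> einterval a b") (simp_all add: B_def R_def in_S(2))
    qed
  qed (use si[OF iA] iA in \<open>auto simp: set_integrable_def\<close>)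
  ultimately have "expect q l - c = (LINT x|lborel. R x)"
    using Bochner_Integration.integral_diff[OF iB iR] intB by simp
  moreover have "gen_expect q (gen_mult f (score p q)) = (LINT x|lborel. R x)"
  proof -
    have "f x * (end_masses S x * indicator S x) = 0" for x
      using stein_sol_at_end[OF pG lp, of x] Sp
      by (auto simp: f end_masses_def indicator_def)
    then show ?thesis
      by (simp add: gen_expect_def expect_def gen_mult_def score_def R_def Sp)
  qed
  ultimately show ?thesis by (simp add: c_def)
qed

end
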